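(* Let $k\ge2$ be an integer, let $X$ be a random variable with values in a measurable space $(S,\Sigma)$ and $Y$ a random variable with values in $[k]=\{1,\dots,k\}$, both defined on the same probability space, and let $p_*$ and $\Delta$ be, respectively, the smallest possible misclassification probability and the total-variation characteristic of the pair $(X,Y)$ (defined in the context). Then $$L(\Delta)\le p_*\le U(\Delta)\le U_{\mathrm{simpl}}(\Delta),$$ where $$L(\Delta):=L_k(\Delta):=1-\frac{1+\Delta}{k},\qquad U(\Delta):=U_k(\Delta):=1-\frac{k+1+\Delta-2\lceil\Delta\rceil}{(k-\lceil\Delta\rceil)(k+1-\lceil\Delta\rceil)},$$ $$U_{\mathrm{simpl}}(\Delta):=U_{k;\mathrm{simpl}}(\Delta):=1-\frac{1}{k-\Delta},$$ and $\lceil\Delta\rceil$ is the smallest integer that is no less than $\Delta$.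
   Context: Let $(\Omega,\mathcal F,\mathsf P)$ be the probability space on which $X$ and $Y$ are defined. For $y\in[k]$, $\mu_y$ is the sub-probability measure on $\Sigma$ given by $\mu_y(B):=\mathsf P(Y=y,\,X\in B)$ for $B\in\Sigma$; $\mu:=\mu_1+\dots+\mu_k$ is the distribution of $X$; and $\rho_y:=\frac{d\mu_y}{d\mu}$ is the density of $\mu_y$ with respect to $\mu$. A classifier is a measurable function $f\colon S\to[k]$; its misclassification probability is $p_f:=\mathsf P(f(X)\ne Y)$. Let $f_*(x)$ be the smallest maximizer of $\rho_y(x)$ in $y\in[k]$. Then $p_*:=p_{f_*}=1-\int_S\max_{1\le y\le k}\rho_y(x)\,\mu(dx)$, and $p_*$ is the smallest value of $p_f$ over all classifiers $f$. $\Delta:=\sum_{1\le y<z\le k}\|\mu_y-\mu_z\|=\sum_{1\le y<z\le k}\int_S|\rho_y-\rho_z|\,d\mu$, where $\|\cdot\|$ is the total variation norm (total mass of the total variation measure, without a factor $1/2$). One always has $0\le\Delta\le k-1$. *)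

theory Defs
  imports "HOL-Probability.Probability"
begin

section \<open>Sub-probability measures and densities\<close>

definition mu :: "'a measure \<Rightarrow> 'b measure \<Rightarrow> ('a \<Rightarrow> 'b) \<Rightarrow> ('a \<Rightarrow> nat) \<Rightarrow> nat \<Rightarrow> 'b measure" where
  "mu M S X Y y = measure_of (space S) (sets S)
     (\<lambda>B. emeasure M {\<omega> \<in> space M. Y \<omega> = y \<and> X \<omega> \<in> B})"

definition rho :: "'a measure \<Rightarrow> 'b measure \<Rightarrow> ('a \<Rightarrow> 'b) \<Rightarrow> ('a \<Rightarrow> nat) \<Rightarrow> nat \<Rightarrow> 'b \<Rightarrow> real" where
  "rho M S X Y y x = enn2real (RN_deriv (distr M S X) (mu M S X Y y) x)"


section \<open>Misclassification probability\<close>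

abbreviation (input) classifiers :: "nat \<Rightarrow> 'b measure \<Rightarrow> ('b \<Rightarrow> nat) set" where
  "classifiers k S \<equiv> S \<rightarrow>\<^sub>M count_space {1..k}"

definition misclass_prob ::
    "'a measure \<Rightarrow> ('a \<Rightarrow> 'b) \<Rightarrow> ('a \<Rightarrow> nat) \<Rightarrow> ('b \<Rightarrow> nat) \<Rightarrow> real" where
  "misclass_prob M X Y f = measure M {\<omega> \<in> space M. f (X \<omega>) \<noteq> Y \<omega>}"

definition f_star ::
    "nat \<Rightarrow> 'a measure \<Rightarrow> 'b measure \<Rightarrow> ('a \<Rightarrow> 'b) \<Rightarrow> ('a \<Rightarrow> nat) \<Rightarrow> 'b \<Rightarrow> nat" where
  "f_star k M S X Y x =
     (LEAST y. is_arg_max (\<lambda>z. rho M S X Y z x) (\<lambda>z. z \<in> {1..k}) y)"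

text \<open>The lemmas \<open>f_star_classifier\<close> and \<open>p_star_le\<close> below show that
  \<open>p_star\<close> is the least misclassification probability over all classifiers.\<close>

definition p_star ::
    "nat \<Rightarrow> 'a measure \<Rightarrow> 'b measure \<Rightarrow> ('a \<Rightarrow> 'b) \<Rightarrow> ('a \<Rightarrow> nat) \<Rightarrow> real" where
  "p_star k M S X Y = misclass_prob M X Y (f_star k M S X Y)"


section \<open>Total variation\<close>

text \<open>The total mass of the total variation measure of a finite signed measure \<open>\<nu>\<close> on
  the measurable space underlying \<open>S\<close> (only \<open>space S\<close> and \<open>sets S\<close> are used); no factor \<open>1/2\<close>.
  On arbitrary set functions the supremum may be unbounded, hence meaningless.\<close>

definition tv_norm :: "'b measure \<Rightarrow> ('b set \<Rightarrow> real) \<Rightarrow> real" where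
  "tv_norm S \<nu> = (SUP P \<in> {P. finite P \<and> P \<subseteq> sets S \<and> disjoint P \<and> \<Union>P = space S}.
     \<Sum>A\<in>P. \<bar>\<nu> A\<bar>)"

definition Delta ::
    "nat \<Rightarrow> 'a measure \<Rightarrow> 'b measure \<Rightarrow> ('a \<Rightarrow> 'b) \<Rightarrow> ('a \<Rightarrow> nat) \<Rightarrow> real" where
  "Delta k M S X Y = (\<Sum>(y, z) \<in> {(y, z). 1 \<le> y \<and> y < z \<and> z \<le> k}.
     tv_norm S (\<lambda>B. measure (mu M S X Y y) B - measure (mu M S X Y z) B))"


section \<open>The bounds\<close>

definition L_bound :: "nat \<Rightarrow> real \<Rightarrow> real" where
  "L_bound k D = 1 - (1 + D) / real k"

definition U_bound :: "nat \<Rightarrow> real \<Rightarrow> real" where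
  "U_bound k D = 1 - (real k + 1 + D - 2 * of_int \<lceil>D\<rceil>) /
     ((real k - of_int \<lceil>D\<rceil>) * (real k + 1 - of_int \<lceil>D\<rceil>))"

definition U_simpl :: "nat \<Rightarrow> real \<Rightarrow> real" where
  "U_simpl k D = 1 - 1 / (real k - D)"


section \<open>Basic properties of these notions\<close>

lemma tv_norm_eq_integral:
  fixes g :: "'b \<Rightarrow> real"
  assumes g: "integrable N g" and sets: "sets N = sets S" and ne: "space S \<noteq> {}"
    and \<nu>: "\<And>A. A \<in> sets S \<Longrightarrow> \<nu> A = (\<integral>x\<in>A. g x \<partial>N)"
  shows "tv_norm S \<nu> = (\<integral>x. \<bar>g x\<bar> \<partial>N)"
proof -
  let ?PP = "{P. finite P \<and> P \<subseteq> sets S \<and> disjoint P \<and> \<Union>P = space S}"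
  have space: "space N = space S"
    using sets by (rule sets_eq_imp_space_eq)
  have gm[measurable]: "g \<in> borel_measurable N"
    using g by simp
  have int_on: "set_integrable N A g" if "A \<in> sets S" for A
    using that g sets unfolding set_integrable_def by (intro integrable_mult_indicator) auto
  define A where "A = {x \<in> space N. 0 \<le> g x}"
  define B where "B = space N - A"
  have A: "A \<in> sets S" and B: "B \<in> sets S"
    unfolding A_def B_def sets[symmetric] by measurable
  have AB: "A \<noteq> B" "A \<inter> B = {}" "A \<union> B = space S"
    using ne space unfolding A_def B_def by auto
  have P: "{A, B} \<in> ?PP"
    using A B AB by (auto simp: disjoint_def)
  have "\<bar>\<nu> A\<bar> + \<bar>\<nu> B\<bar> = (\<integral>x. \<bar>g x\<bar> \<partial>N)"
  proof -
    have "0 \<le> \<nu> A"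
      unfolding \<nu>[OF A] set_lebesgue_integral_def
      by (intro integral_nonneg_AE AE_I2) (auto simp: A_def indicator_def)
    moreover have "\<nu> B \<le> 0"
    proof -
      have "0 \<le> (\<integral>x. - (indicator B x *\<^sub>R g x) \<partial>N)"
        by (intro integral_nonneg_AE AE_I2) (auto simp: A_def B_def indicator_def)
      then show ?thesis
        unfolding \<nu>[OF B] set_lebesgue_integral_def by simp
    qed
    ultimately have "\<bar>\<nu> A\<bar> + \<bar>\<nu> B\<bar> = \<nu> A - \<nu> B"
      by simp
    also have "\<dots> = (\<integral>x. indicator A x *\<^sub>R g x - indicator B x *\<^sub>R g x \<partial>N)"
      using int_on[OF A] int_on[OF B] unfolding \<nu>[OF A] \<nu>[OF B] set_lebesgue_integral_def
        set_integrable_def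
      by (intro Bochner_Integration.integral_diff[symmetric])
    also have "\<dots> = (\<integral>x. \<bar>g x\<bar> \<partial>N)"
      by (intro Bochner_Integration.integral_cong) (auto simp: A_def B_def indicator_def)
    finally show ?thesis .
  qed
  then have attained: "(\<integral>x. \<bar>g x\<bar> \<partial>N) = (\<Sum>A\<in>{A, B}. \<bar>\<nu> A\<bar>)"
    using AB by simp
  have bound: "(\<Sum>A\<in>P. \<bar>\<nu> A\<bar>) \<le> (\<integral>x. \<bar>g x\<bar> \<partial>N)" if "P \<in> ?PP" for P
  proof -
    have fin: "finite P" and sub: "P \<subseteq> sets S" and dis: "disjoint P" and un: "\<Union>P = space S"
      using that by auto
    have "(\<Sum>A\<in>P. \<bar>\<nu> A\<bar>) \<le> (\<Sum>A\<in>P. \<integral>x. indicator A x *\<^sub>R \<bar>g x\<bar> \<partial>N)"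
    proof (rule sum_mono)
      fix A assume "A \<in> P"
      then have "A \<in> sets S"
        using sub by auto
      then have "\<bar>\<nu> A\<bar> \<le> (\<integral>x. \<bar>indicator A x *\<^sub>R g x\<bar> \<partial>N)"
        unfolding \<nu>[OF \<open>A \<in> sets S\<close>] set_lebesgue_integral_def
        by (simp only: real_norm_def[symmetric] integral_norm_bound)
      then show "\<bar>\<nu> A\<bar> \<le> (\<integral>x. indicator A x *\<^sub>R \<bar>g x\<bar> \<partial>N)"
        by (simp add: abs_mult)
    qed
    also have "\<dots> = (\<integral>x. (\<Sum>A\<in>P. indicator A x *\<^sub>R \<bar>g x\<bar>) \<partial>N)"
      using sub g sets
      by (intro Bochner_Integration.integral_sum[symmetric] integrable_mult_indicator) auto
    also have "\<dots> = (\<integral>x. \<bar>g x\<bar> \<partial>N)"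
    proof (rule Bochner_Integration.integral_cong)
      fix x assume "x \<in> space N"
      then obtain C where C: "C \<in> P" "x \<in> C"
        using un space by auto
      have "(\<Sum>A\<in>P. indicator A x *\<^sub>R \<bar>g x\<bar>) = (\<Sum>A\<in>P. if A = C then \<bar>g x\<bar> else 0)"
        using C dis by (intro sum.cong) (auto simp: indicator_def disjoint_def)
      also have "\<dots> = \<bar>g x\<bar>"
        using C fin by simp
      finally show "(\<Sum>A\<in>P. indicator A x *\<^sub>R \<bar>g x\<bar>) = \<bar>g x\<bar>" .
    qed simp
    finally show ?thesis .
  qed
  show ?thesis
    unfolding tv_norm_def
  proof (rule cSup_eq_maximum)
    show "(\<integral>x. \<bar>g x\<bar> \<partial>N) \<in> (\<lambda>P. \<Sum>A\<in>P. \<bar>\<nu> A\<bar>) ` ?PP"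
      using P attained by blast
  qed (use bound in auto)
qed

locale classification = prob_space M for M :: "'a measure" +
  fixes S :: "'b measure" and X :: "'a \<Rightarrow> 'b" and Y :: "'a \<Rightarrow> nat" and k :: nat
  assumes X[measurable]: "X \<in> M \<rightarrow>\<^sub>M S"
    and Y: "Y \<in> M \<rightarrow>\<^sub>M count_space {1..k}"
begin

lemma Y_measurable[measurable]: "Y \<in> M \<rightarrow>\<^sub>M count_space UNIV"
  using measurable_compose[OF Y, of "\<lambda>x. x" "count_space UNIV"] by simp

lemma Y_range: "\<omega> \<in> space M \<Longrightarrow> Y \<omega> \<in> {1..k}"
  using measurable_space[OF Y] by auto

lemma emeasure_mu_distr:
  assumes [measurable]: "B \<in> sets S"
  shows "emeasure (distr (density M (indicator {\<omega> \<in> space M. Y \<omega> = y})) S X) B =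
    emeasure M {\<omega> \<in> space M. Y \<omega> = y \<and> X \<omega> \<in> B}" (is "emeasure (distr (density M (indicator ?E)) S X) B = _")
proof -
  have "emeasure (distr (density M (indicator ?E)) S X) B =
      (\<integral>\<^sup>+\<omega>. indicator ?E \<omega> * indicator (X -` B \<inter> space M) \<omega> \<partial>M)"
    by (simp add: emeasure_distr emeasure_density)
  also have "\<dots> = (\<integral>\<^sup>+\<omega>. indicator {\<omega> \<in> space M. Y \<omega> = y \<and> X \<omega> \<in> B} \<omega> \<partial>M)"
    by (intro nn_integral_cong) (auto simp: indicator_def)
  finally show ?thesis by simp
qed

lemma mu_eq_distr:
  "mu M S X Y y = distr (density M (indicator {\<omega> \<in> space M. Y \<omega> = y})) S X" (is "_ = ?N")
proof -
  have "?N = measure_of (space ?N) (sets ?N) (emeasure ?N)"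
    by (rule measure_of_of_measure[symmetric])
  also have "\<dots> = mu M S X Y y"
    unfolding mu_def space_distr sets_distr
    by (intro measure_of_eq sets.space_closed) (simp add: sets.sigma_sets_eq emeasure_mu_distr)
  finally show ?thesis by simp
qed

lemma sets_mu[measurable_cong, simp]: "sets (mu M S X Y y) = sets S"
  by (simp add: mu_eq_distr)

lemma emeasure_mu:
  "B \<in> sets S \<Longrightarrow>
    emeasure (mu M S X Y y) B = emeasure M {\<omega> \<in> space M. Y \<omega> = y \<and> X \<omega> \<in> B}"
  by (simp add: mu_eq_distr emeasure_mu_distr)

lemma measure_mu:
  "B \<in> sets S \<Longrightarrow> measure (mu M S X Y y) B = measure M {\<omega> \<in> space M. Y \<omega> = y \<and> X \<omega> \<in> B}"
  by (simp add: measure_def emeasure_mu)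

lemma finite_measure_mu: "finite_measure (mu M S X Y y)"
proof
  have "space (mu M S X Y y) = space S"
    by (rule sets_eq_imp_space_eq) simp
  then show "emeasure (mu M S X Y y) (space (mu M S X Y y)) \<noteq> \<infinity>"
    by (simp add: emeasure_mu emeasure_eq_measure)
qed

sublocale N: prob_space "distr M S X"
  by (rule prob_space_distr) (rule X)

lemma mu_absolutely_continuous: "absolutely_continuous (distr M S X) (mu M S X Y y)"
  unfolding absolutely_continuous_def
proof
  fix B assume "B \<in> null_sets (distr M S X)"
  then have B[measurable]: "B \<in> sets S" and 0: "emeasure M (X -` B \<inter> space M) = 0"
    by (auto simp: null_sets_def emeasure_distr)
  have "emeasure M {\<omega> \<in> space M. Y \<omega> = y \<and> X \<omega> \<in> B} \<le> emeasure M (X -` B \<inter> space M)"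
    by (intro emeasure_mono) auto
  then show "B \<in> null_sets (mu M S X Y y)"
    using 0 B by (simp add: null_sets_def emeasure_mu)
qed

lemma rho_measurable[measurable]: "rho M S X Y y \<in> borel_measurable S"
proof -
  have "RN_deriv (distr M S X) (mu M S X Y y) \<in> borel_measurable S"
    using borel_measurable_RN_deriv[of "distr M S X" "mu M S X Y y"]
    by (simp cong: measurable_cong_sets)
  then show ?thesis
    unfolding rho_def[abs_def] by measurable
qed

lemma rho_nonneg: "0 \<le> rho M S X Y y x"
  by (simp add: rho_def)

lemma density_rho: "density (distr M S X) (\<lambda>x. ennreal (rho M S X Y y x)) = mu M S X Y y"
proof -
  interpret \<mu>: finite_measure "mu M S X Y y"
    by (rule finite_measure_mu)
  have "AE x in distr M S X. RN_deriv (distr M S X) (mu M S X Y y) x \<noteq> \<infinity>"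
    by (rule N.RN_deriv_finite) (simp_all add: mu_absolutely_continuous \<mu>.sigma_finite_measure_axioms)
  then have "AE x in distr M S X.
      ennreal (rho M S X Y y x) = RN_deriv (distr M S X) (mu M S X Y y) x"
    by eventually_elim (auto simp: rho_def less_top)
  then have "density (distr M S X) (\<lambda>x. ennreal (rho M S X Y y x)) =
      density (distr M S X) (RN_deriv (distr M S X) (mu M S X Y y))"
    by (intro density_cong) auto
  also have "\<dots> = mu M S X Y y"
    by (rule N.density_RN_deriv) (simp_all add: mu_absolutely_continuous)
  finally show ?thesis .
qed

lemma rho_integrable: "integrable (distr M S X) (rho M S X Y y)"
proof (rule integrableI_nonneg)
  have "(\<integral>\<^sup>+x. ennreal (rho M S X Y y x) \<partial>distr M S X) = emeasure (mu M S X Y y) (space S)"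
    unfolding density_rho[symmetric]
    by (subst emeasure_density) (auto intro!: nn_integral_cong)
  also have "\<dots> < \<infinity>"
    by (simp add: emeasure_mu emeasure_eq_measure)
  finally show "(\<integral>\<^sup>+x. ennreal (rho M S X Y y x) \<partial>distr M S X) < \<infinity>" .
qed (auto simp: rho_nonneg)

lemma rho_set_integrable: "A \<in> sets S \<Longrightarrow> set_integrable (distr M S X) A (rho M S X Y y)"
  unfolding set_integrable_def by (intro integrable_mult_indicator rho_integrable) auto

lemma measure_mu_eq_integral:
  assumes A[measurable]: "A \<in> sets S"
  shows "measure (mu M S X Y y) A = (\<integral>x\<in>A. rho M S X Y y x \<partial>distr M S X)"
proof -
  have "emeasure (mu M S X Y y) A =
      (\<integral>\<^sup>+x. ennreal (rho M S X Y y x) * indicator A x \<partial>distr M S X)"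
    unfolding density_rho[symmetric] by (subst emeasure_density) auto
  also have "\<dots> = (\<integral>\<^sup>+x. ennreal (indicator A x *\<^sub>R rho M S X Y y x) \<partial>distr M S X)"
    by (intro nn_integral_cong) (auto simp: indicator_def)
  also have "\<dots> = ennreal (\<integral>x\<in>A. rho M S X Y y x \<partial>distr M S X)"
    unfolding set_lebesgue_integral_def
    using rho_set_integrable[OF A, of y]
    by (intro nn_integral_eq_integral) (auto simp: set_integrable_def rho_nonneg)
  finally show ?thesis
    unfolding measure_def set_lebesgue_integral_def
    by (simp add: integral_nonneg_AE rho_nonneg)
qed

lemma Delta_eq_integral:
  "Delta k M S X Y = (\<Sum>(y, z) \<in> {(y, z). 1 \<le> y \<and> y < z \<and> z \<le> k}.
     \<integral>x. \<bar>rho M S X Y y x - rho M S X Y z x\<bar> \<partial>distr M S X)"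
proof -
  have "tv_norm S (\<lambda>B. measure (mu M S X Y y) B - measure (mu M S X Y z) B) =
      (\<integral>x. \<bar>rho M S X Y y x - rho M S X Y z x\<bar> \<partial>distr M S X)" for y z
  proof (rule tv_norm_eq_integral)
    show "space S \<noteq> {}"
      using N.not_empty by simp
    show "measure (mu M S X Y y) A - measure (mu M S X Y z) A =
        (\<integral>x\<in>A. rho M S X Y y x - rho M S X Y z x \<partial>distr M S X)" if "A \<in> sets S" for A
      using that by (simp add: measure_mu_eq_integral set_integral_diff rho_set_integrable)
  qed (simp_all add: rho_integrable)
  then show ?thesis
    unfolding Delta_def by simp
qed

lemma f_star_is_arg_max:
  assumes "x \<in> space S"
  shows "is_arg_max (\<lambda>z. rho M S X Y z x) (\<lambda>z. z \<in> {1..k}) (f_star k M S X Y x)"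
proof -
  have "k \<ge> 1"
    using not_empty Y_range by fastforce
  then obtain y where "is_arg_max (\<lambda>z. rho M S X Y z x) (\<lambda>z. z \<in> {1..k}) y"
    using ex_is_arg_min_if_finite[of "{1..k}" "\<lambda>z. - rho M S X Y z x"]
    by (auto simp: is_arg_min_def is_arg_max_def)
  then show ?thesis
    unfolding f_star_def by (rule LeastI)
qed

lemma f_star_classifier: "f_star k M S X Y \<in> classifiers k S"
proof -
  have "f_star k M S X Y \<in> S \<rightarrow>\<^sub>M count_space UNIV"
    unfolding f_star_def is_arg_max_def Bex_def[symmetric]
    by measurable
  moreover have "f_star k M S X Y x \<in> {1..k}" if "x \<in> space S" for x
    using f_star_is_arg_max[OF that] by (simp add: is_arg_max_def)
  ultimately show ?thesis
    by (auto simp: measurable_def Pi_iff)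
qed

lemma misclass_prob_eq_integral:
  assumes f: "f \<in> classifiers k S"
  shows "integrable (distr M S X) (\<lambda>x. rho M S X Y (f x) x)"
    and "misclass_prob M X Y f = 1 - (\<integral>x. rho M S X Y (f x) x \<partial>distr M S X)"
proof -
  have [measurable]: "f \<in> S \<rightarrow>\<^sub>M count_space UNIV"
    using measurable_compose[OF f, of "\<lambda>x. x" "count_space UNIV"] by simp
  define F where "F y = {x \<in> space S. f x = y}" for y
  have F[measurable]: "F y \<in> sets S" for y
    unfolding F_def by measurable
  have split: "rho M S X Y (f x) x = (\<Sum>y\<in>{1..k}. indicator (F y) x *\<^sub>R rho M S X Y y x)"
    if "x \<in> space S" for x
  proof -
    have "(\<Sum>y\<in>{1..k}. indicator (F y) x *\<^sub>R rho M S X Y y x) =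
        (\<Sum>y\<in>{1..k}. if y = f x then rho M S X Y y x else 0)"
      using that by (intro sum.cong) (auto simp: F_def indicator_def)
    then show ?thesis
      using measurable_space[OF f that] by simp
  qed
  have int: "integrable (distr M S X) (\<lambda>x. indicator (F y) x *\<^sub>R rho M S X Y y x)" for y
    using rho_set_integrable[OF F] by (simp add: set_integrable_def)
  then have "integrable (distr M S X) (\<lambda>x. \<Sum>y\<in>{1..k}. indicator (F y) x *\<^sub>R rho M S X Y y x)"
    by (intro Bochner_Integration.integrable_sum)
  then show "integrable (distr M S X) (\<lambda>x. rho M S X Y (f x) x)"
    by (rule Bochner_Integration.integrable_cong[THEN iffD1, rotated 2]) (auto simp: split)
  have "(\<integral>x. rho M S X Y (f x) x \<partial>distr M S X) =
      (\<integral>x. (\<Sum>y\<in>{1..k}. indicator (F y) x *\<^sub>R rho M S X Y y x) \<partial>distr M S X)"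
    by (intro Bochner_Integration.integral_cong) (auto simp: split)
  also have "\<dots> = (\<Sum>y\<in>{1..k}. measure (mu M S X Y y) (F y))"
    by (subst Bochner_Integration.integral_sum[OF int])
       (simp add: measure_mu_eq_integral[OF F] set_lebesgue_integral_def)
  also have "\<dots> = (\<Sum>y\<in>{1..k}. prob {\<omega> \<in> space M. Y \<omega> = y \<and> f (X \<omega>) = y})"
  proof (intro sum.cong refl)
    fix y
    have "{\<omega> \<in> space M. Y \<omega> = y \<and> X \<omega> \<in> F y} = {\<omega> \<in> space M. Y \<omega> = y \<and> f (X \<omega>) = y}"
      using measurable_space[OF X] by (auto simp: F_def)
    then show "measure (mu M S X Y y) (F y) = prob {\<omega> \<in> space M. Y \<omega> = y \<and> f (X \<omega>) = y}"
      by (simp add: measure_mu)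
  qed
  also have "\<dots> = prob (\<Union>y\<in>{1..k}. {\<omega> \<in> space M. Y \<omega> = y \<and> f (X \<omega>) = y})"
    by (intro finite_measure_finite_Union[symmetric]) (auto simp: disjoint_family_on_def)
  also have "(\<Union>y\<in>{1..k}. {\<omega> \<in> space M. Y \<omega> = y \<and> f (X \<omega>) = y}) =
      space M - {\<omega> \<in> space M. f (X \<omega>) \<noteq> Y \<omega>}"
    using Y_range by auto
  also have "prob \<dots> = 1 - misclass_prob M X Y f"
  proof -
    have "{\<omega> \<in> space M. f (X \<omega>) \<noteq> Y \<omega>} =
        (\<Union>y\<in>{1..k}. {\<omega> \<in> space M. Y \<omega> = y \<and> f (X \<omega>) \<noteq> y})"
      using Y_range by auto
    also have "\<dots> \<in> events"
      by measurable
    finally have "{\<omega> \<in> space M. f (X \<omega>) \<noteq> Y \<omega>} \<in> events" .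
    then show ?thesis
      unfolding misclass_prob_def by (rule prob_compl)
  qed
  finally show "misclass_prob M X Y f = 1 - (\<integral>x. rho M S X Y (f x) x \<partial>distr M S X)"
    by simp
qed

lemma p_star_eq_integral:
  "p_star k M S X Y = 1 - (\<integral>x. (MAX y\<in>{1..k}. rho M S X Y y x) \<partial>distr M S X)"
proof -
  have "rho M S X Y (f_star k M S X Y x) x = (MAX y\<in>{1..k}. rho M S X Y y x)"
    if "x \<in> space S" for x
    using f_star_is_arg_max[OF that]
    by (intro Max_eqI[symmetric]) (auto simp: is_arg_max_linorder)
  then show ?thesis
    unfolding p_star_def misclass_prob_eq_integral(2)[OF f_star_classifier]
    by (intro arg_cong[where f = "\<lambda>t. 1 - t"] Bochner_Integration.integral_cong) auto
qed

lemma p_star_le: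
  assumes f: "f \<in> classifiers k S"
  shows "p_star k M S X Y \<le> misclass_prob M X Y f"
proof -
  have "(\<integral>x. rho M S X Y (f x) x \<partial>distr M S X) \<le>
      (\<integral>x. rho M S X Y (f_star k M S X Y x) x \<partial>distr M S X)"
  proof (intro integral_mono misclass_prob_eq_integral(1) f f_star_classifier)
    fix x assume "x \<in> space (distr M S X)"
    then have x: "x \<in> space S" by simp
    show "rho M S X Y (f x) x \<le> rho M S X Y (f_star k M S X Y x) x"
      using f_star_is_arg_max[OF x] measurable_space[OF f x] by (auto simp: is_arg_max_linorder)
  qed
  then show ?thesis
    unfolding p_star_def misclass_prob_eq_integral(2)[OF f]
      misclass_prob_eq_integral(2)[OF f_star_classifier] by simp
qed

end

end

theory Submission
  imports Defs
begin

text \<open>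
  The bounds on \<open>p\<^sub>*\<close> hold pointwise and are integrated against the law of \<open>X\<close>.
  At a point \<open>x\<close> let \<open>m\<close> be the largest density, \<open>s\<close> the sum of the \<open>k\<close> densities and
  \<open>\<delta>\<close> the sum of \<open>\<bar>\<rho>\<^sub>y - \<rho>\<^sub>z\<bar>\<close> over pairs \<open>y < z\<close>. The integrals of \<open>m\<close>, \<open>s\<close> and \<open>\<delta>\<close> are
  \<open>1 - p\<^sub>*\<close>, \<open>1\<close> and \<open>\<Delta>\<close>, so a linear inequality between \<open>m\<close>, \<open>s\<close> and \<open>\<delta>\<close> turns into one
  between \<open>p\<^sub>*\<close> and \<open>\<Delta>\<close>.

  The lower bound comes from \<open>k m - s \<le> \<delta>\<close>: the left side is the part of \<open>\<delta>\<close> contributed by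
  the pairs containing one fixed maximizer (lemma \<open>card_mult_max_minus_sum_le\<close>).

  For the upper bound, \<open>1 - U\<close> is a convex piecewise linear function of \<open>\<Delta>\<close> with nodes at the
  integers. Instead of appealing to Jensen's inequality, one uses its linear pieces separately:
  the piece that is active for \<open>\<lceil>\<Delta>\<rceil> = k - r\<close> is a pointwise lower bound of \<open>m\<close>, namely
  \<open>\<delta> \<le> (k - 1 - 2 r) s + r (r + 1) m\<close>, which holds for every natural number \<open>r\<close>
  (lemma \<open>sum_abs_diff_le\<close>). To see why, sort the densities decreasingly as
  \<open>\<rho>\<^sub>1 \<ge> \<dots> \<ge> \<rho>\<^sub>k\<close>; then \<open>\<delta>\<close> is the sum of the \<open>(k + 1 - 2 i) \<rho>\<^sub>i\<close>, and the claim says that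
  the sum of the \<open>(r + 1 - i) \<rho>\<^sub>i\<close> is at most \<open>r (r + 1) m / 2\<close>, where the terms with
  \<open>i > r\<close> can be dropped and \<open>\<rho>\<^sub>i \<le> m\<close> is used in the others. The case \<open>r = 0\<close> gives
  \<open>\<Delta> \<le> k - 1\<close>, hence \<open>r \<ge> 1\<close> for the active piece.

  Finally, \<open>1 - U\<close> interpolates the convex function \<open>1 / (k - \<Delta>)\<close> linearly between consecutive
  integers and therefore lies above it.
\<close>

section \<open>Pairwise differences of finitely many numbers\<close>

lemma sum_symmetric_eq_twice_sum_less:
  fixes g :: "'i::linorder \<Rightarrow> 'i \<Rightarrow> real"
  assumes A: "finite A" and sym: "\<And>y z. g y z = g z y" and diag: "\<And>y. g y y = 0"
  shows "(\<Sum>y\<in>A. \<Sum>z\<in>A. g y z) = 2 * (\<Sum>(y, z)\<in>{(y, z). y \<in> A \<and> z \<in> A \<and> y < z}. g y z)"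
proof -
  let ?U = "{(y, z). y \<in> A \<and> z \<in> A \<and> y < z}" and ?L = "{(y, z). y \<in> A \<and> z \<in> A \<and> z < y}"
  have fin: "finite ?U" "finite ?L"
    by (rule finite_subset[of _ "A \<times> A"]; use A in auto)+
  have "(\<Sum>y\<in>A. \<Sum>z\<in>A. g y z) = (\<Sum>(y, z)\<in>A \<times> A. g y z)"
    by (rule sum.cartesian_product)
  also have "\<dots> = (\<Sum>(y, z)\<in>?U \<union> ?L. g y z)"
    using A by (intro sum.mono_neutral_right) (auto simp: not_less_iff_gr_or_eq diag)
  also have "\<dots> = (\<Sum>(y, z)\<in>?U. g y z) + (\<Sum>(y, z)\<in>?L. g y z)"
    using fin by (intro sum.union_disjoint) auto
  also have "(\<Sum>(y, z)\<in>?L. g y z) = (\<Sum>(y, z)\<in>?U. g y z)"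
    by (rule sum.reindex_bij_witness[of _ prod.swap prod.swap]) (auto simp: sym)
  finally show ?thesis by simp
qed

text \<open>The induction adds the numbers in decreasing order, so that the new number \<open>t x\<close> has known
  differences to the \<open>n\<close> earlier ones. The bound follows from the previous one when \<open>r \<le> n\<close>.
  When \<open>r > n\<close>, the bound for \<open>r\<close> is weaker than the one for \<open>n\<close>.\<close>

lemma sum_abs_diff_le:
  fixes t :: "'i \<Rightarrow> real"
  assumes "finite A" and "0 \<le> m" and "\<And>y. y \<in> A \<Longrightarrow> 0 \<le> t y \<and> t y \<le> m"
  shows "(\<Sum>y\<in>A. \<Sum>z\<in>A. \<bar>t y - t z\<bar>) \<le>
    2 * ((real (card A) - 1 - 2 * real r) * (\<Sum>y\<in>A. t y) + real r * (real r + 1) * m)"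
  using assms(1,3)
proof (induction A arbitrary: r rule: finite_ranking_induct[where f = "\<lambda>y. - t y"])
  case empty
  then show ?case using \<open>0 \<le> m\<close> by simp
next
  case (insert x A)
  show ?case
  proof (cases "x \<in> A")
    case True
    then show ?thesis using insert by (simp add: insert_absorb)
  next
    case False
    let ?n = "real (card A)" and ?s = "\<Sum>y\<in>A. t y"
    let ?D = "\<Sum>y\<in>insert x A. \<Sum>z\<in>insert x A. \<bar>t y - t z\<bar>"
    have x: "0 \<le> t x" "t x \<le> m" using insert.prems by auto
    have "(\<Sum>z\<in>A. \<bar>t x - t z\<bar>) = (\<Sum>z\<in>A. t z - t x)"
      using insert.hyps(2) by (intro sum.cong) force+
    then have new: "(\<Sum>z\<in>A. \<bar>t x - t z\<bar>) = ?s - ?n * t x"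
      by (simp add: sum_subtractf)
    have D: "?D = (\<Sum>y\<in>A. \<Sum>z\<in>A. \<bar>t y - t z\<bar>) + 2 * (?s - ?n * t x)"
      using False insert.hyps(1) new
      by (simp add: sum.distrib abs_minus_commute[of "t x"])
    have small: "?D \<le> 2 * ((?n - 2 * real q) * (?s + t x) + real q * (real q + 1) * m)"
      if "q \<le> card A" for q
    proof -
      have "0 \<le> (?n - real q) * t x" using that x by simp
      then show ?thesis
        using insert.IH[of q] insert.prems D by (simp add: algebra_simps)
    qed
    have "?D \<le> 2 * ((?n - 2 * real r) * (?s + t x) + real r * (real r + 1) * m)"
    proof (cases "r \<le> card A")
      case True
      then show ?thesis by (rule small)
    next
      case False
      have "?s \<le> ?n * m"
        using sum_bounded_above[of A t m] insert.prems by simp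
      then have "2 * (?s + t x) \<le> (2 * ?n + 2) * m"
        using x by (simp add: algebra_simps)
      also have "\<dots> \<le> (real r + ?n + 1) * m"
        using False \<open>0 \<le> m\<close> by (intro mult_right_mono) auto
      finally have "0 \<le> (real r - ?n) * ((real r + ?n + 1) * m - 2 * (?s + t x))"
        using False by (intro mult_nonneg_nonneg) auto
      then show ?thesis
        using small[of "card A"] by (simp add: algebra_simps)
    qed
    then show ?thesis using False insert.hyps(1) by (simp add: add.commute)
  qed
qed

lemma card_mult_max_minus_sum_le:
  fixes t :: "'i \<Rightarrow> real"
  assumes "finite A" and w: "w \<in> A" and "\<And>y. y \<in> A \<Longrightarrow> t y \<le> t w"
  shows "2 * (real (card A) * t w - (\<Sum>y\<in>A. t y)) \<le> (\<Sum>y\<in>A. \<Sum>z\<in>A. \<bar>t y - t z\<bar>)"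
proof -
  let ?e = "\<Sum>z\<in>A. \<bar>t w - t z\<bar>"
  have e: "?e = real (card A) * t w - (\<Sum>y\<in>A. t y)"
  proof -
    have "?e = (\<Sum>z\<in>A. t w - t z)" using assms(3) by (intro sum.cong) auto
    then show ?thesis by (simp add: sum_subtractf)
  qed
  \<comment> \<open>The ordered pairs containing \<open>w\<close> form the row and the column of \<open>w\<close>, each of sum \<open>?e\<close>.\<close>
  define row where "row y = (\<Sum>z\<in>A. \<bar>t y - t z\<bar>)" for y
  have "row w = (\<Sum>y\<in>A - {w}. \<bar>t y - t w\<bar>)"
    unfolding row_def using assms(1) w
    by (subst sum.remove[of A w]) (auto simp: abs_minus_commute)
  also have "\<dots> \<le> (\<Sum>y\<in>A - {w}. row y)"
    unfolding row_def using assms(1) w by (intro sum_mono member_le_sum) auto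
  finally have "2 * row w \<le> (\<Sum>y\<in>A. row y)"
    using sum.remove[OF assms(1) w, of row] by simp
  then show ?thesis unfolding row_def e .
qed

section \<open>Integrated inequalities\<close>

context classification
begin

lemma k_pos: "0 < k"
  using not_empty Y_range by fastforce

text \<open>Ordered pairs are used because their sum is easy to split when one index is
  singled out, whatever its position in \<open>{1..k}\<close>.\<close>

lemma twice_Delta_eq_integral:
  "2 * Delta k M S X Y = (\<integral>x. (\<Sum>y\<in>{1..k}. \<Sum>z\<in>{1..k}.
     \<bar>rho M S X Y y x - rho M S X Y z x\<bar>) \<partial>distr M S X)"
proof -
  define I where "I y z = (\<integral>x. \<bar>rho M S X Y y x - rho M S X Y z x\<bar> \<partial>distr M S X)" for y z
  have pairs: "{(y, z). 1 \<le> y \<and> y < z \<and> z \<le> k} = {(y, z). y \<in> {1..k} \<and> z \<in> {1..k} \<and> y < z}"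
    by auto
  have "2 * Delta k M S X Y = (\<Sum>y\<in>{1..k}. \<Sum>z\<in>{1..k}. I y z)"
    unfolding Delta_eq_integral pairs I_def[symmetric]
    by (rule sum_symmetric_eq_twice_sum_less[symmetric]) (auto simp: I_def abs_minus_commute)
  also have "\<dots> = (\<integral>x. (\<Sum>y\<in>{1..k}. \<Sum>z\<in>{1..k}.
     \<bar>rho M S X Y y x - rho M S X Y z x\<bar>) \<partial>distr M S X)"
    unfolding I_def by (simp add: rho_integrable)
  finally show ?thesis .
qed

text \<open>The densities add up to \<open>1\<close> almost everywhere. Because the sum enters the pointwise
  inequalities linearly, only its integral matters, namely the total probability of the
  events \<open>Y = y\<close>.\<close>

lemma integral_sum_rho: "(\<integral>x. (\<Sum>y\<in>{1..k}. rho M S X Y y x) \<partial>distr M S X) = 1"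
proof -
  have "(\<integral>x. (\<Sum>y\<in>{1..k}. rho M S X Y y x) \<partial>distr M S X) =
      (\<Sum>y\<in>{1..k}. \<integral>x. rho M S X Y y x \<partial>distr M S X)"
    by (simp add: rho_integrable)
  also have "\<dots> = (\<Sum>y\<in>{1..k}. prob {\<omega> \<in> space M. Y \<omega> = y})"
  proof (intro sum.cong refl)
    fix y
    have "(\<integral>x. rho M S X Y y x \<partial>distr M S X) = measure (mu M S X Y y) (space S)"
      using measure_mu_eq_integral[OF sets.top, of y]
        set_integral_space[OF rho_integrable, of y] by simp
    also have "\<dots> = prob {\<omega> \<in> space M. Y \<omega> = y}"
      unfolding measure_mu[OF sets.top]
      using measurable_space[OF X] by (intro arg_cong[where f = prob]) auto
    finally show "(\<integral>x. rho M S X Y y x \<partial>distr M S X) = prob {\<omega> \<in> space M. Y \<omega> = y}" .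
  qed
  also have "\<dots> = prob (\<Union>y\<in>{1..k}. {\<omega> \<in> space M. Y \<omega> = y})"
    by (intro finite_measure_finite_Union[symmetric]) (auto simp: disjoint_family_on_def)
  also have "(\<Union>y\<in>{1..k}. {\<omega> \<in> space M. Y \<omega> = y}) = space M"
    using Y_range by auto
  finally show ?thesis by (simp add: prob_space)
qed

lemma Delta_le:
  "Delta k M S X Y \<le>
    (real k - 1 - 2 * real r) + real r * (real r + 1) * (1 - p_star k M S X Y)"
proof -
  let ?m = "\<lambda>x. rho M S X Y (f_star k M S X Y x) x"
  note int = misclass_prob_eq_integral[OF f_star_classifier]
  let ?s = "\<lambda>x. \<Sum>y\<in>{1..k}. rho M S X Y y x"
  have ints: "integrable (distr M S X) ?s" by (simp add: rho_integrable)
  have "2 * Delta k M S X Y \<le> (\<integral>x. 2 * ((real k - 1 - 2 * real r) * ?s x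
      + real r * (real r + 1) * ?m x) \<partial>distr M S X)"
    unfolding twice_Delta_eq_integral
  proof (rule integral_mono)
    fix x assume "x \<in> space (distr M S X)"
    then have "is_arg_max (\<lambda>z. rho M S X Y z x) (\<lambda>z. z \<in> {1..k}) (f_star k M S X Y x)"
      unfolding space_distr by (rule f_star_is_arg_max)
    then show "(\<Sum>y\<in>{1..k}. \<Sum>z\<in>{1..k}. \<bar>rho M S X Y y x - rho M S X Y z x\<bar>) \<le>
        2 * ((real k - 1 - 2 * real r) * ?s x + real r * (real r + 1) * ?m x)"
      using sum_abs_diff_le[of "{1..k}" "?m x" "\<lambda>y. rho M S X Y y x" r]
      by (auto simp: is_arg_max_linorder rho_nonneg)
  qed (use ints int(1) in \<open>simp_all add: rho_integrable\<close>)
  also have "\<dots> = 2 * ((real k - 1 - 2 * real r)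
      + real r * (real r + 1) * (1 - p_star k M S X Y))"
    using ints int by (simp add: integral_sum_rho p_star_def del: Bochner_Integration.integral_sum One_nat_def)
  finally show ?thesis by simp
qed

lemma le_Delta: "real k * (1 - p_star k M S X Y) - 1 \<le> Delta k M S X Y"
proof -
  let ?m = "\<lambda>x. rho M S X Y (f_star k M S X Y x) x"
  note int = misclass_prob_eq_integral[OF f_star_classifier]
  let ?s = "\<lambda>x. \<Sum>y\<in>{1..k}. rho M S X Y y x"
  have ints: "integrable (distr M S X) ?s" by (simp add: rho_integrable)
  have "2 * (real k * (1 - p_star k M S X Y) - 1) =
      (\<integral>x. 2 * (real k * ?m x - ?s x) \<partial>distr M S X)"
    using ints int by (simp add: integral_sum_rho p_star_def del: Bochner_Integration.integral_sum One_nat_def)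
  also have "\<dots> \<le> 2 * Delta k M S X Y"
    unfolding twice_Delta_eq_integral
  proof (rule integral_mono)
    fix x assume "x \<in> space (distr M S X)"
    then have "is_arg_max (\<lambda>z. rho M S X Y z x) (\<lambda>z. z \<in> {1..k}) (f_star k M S X Y x)"
      unfolding space_distr by (rule f_star_is_arg_max)
    then show "2 * (real k * ?m x - ?s x) \<le>
        (\<Sum>y\<in>{1..k}. \<Sum>z\<in>{1..k}. \<bar>rho M S X Y y x - rho M S X Y z x\<bar>)"
      using card_mult_max_minus_sum_le[of "{1..k}" "f_star k M S X Y x" "\<lambda>y. rho M S X Y y x"]
      by (auto simp: is_arg_max_linorder)
  qed (use ints int(1) in \<open>simp_all add: rho_integrable\<close>)
  finally show ?thesis by simp
qed

lemma L_bound_le_p_star: "L_bound k (Delta k M S X Y) \<le> p_star k M S X Y"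
  using le_Delta k_pos by (simp add: L_bound_def field_simps)

lemma ceiling_Delta_eq_diff:
  obtains r :: nat where "1 \<le> r" and "of_int \<lceil>Delta k M S X Y\<rceil> = real k - real r"
proof
  have "\<lceil>Delta k M S X Y\<rceil> \<le> int k - 1"
    using Delta_le[of 0] unfolding ceiling_le_iff by simp
  then show "1 \<le> nat (int k - \<lceil>Delta k M S X Y\<rceil>)"
    and "of_int \<lceil>Delta k M S X Y\<rceil> = real k - real (nat (int k - \<lceil>Delta k M S X Y\<rceil>))"
    by auto
qed

lemma p_star_le_U_bound: "p_star k M S X Y \<le> U_bound k (Delta k M S X Y)"
proof -
  obtain r where r: "1 \<le> r" "of_int \<lceil>Delta k M S X Y\<rceil> = real k - real r"
    by (rule ceiling_Delta_eq_diff)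
  have "(2 * real r + 1 - real k + Delta k M S X Y) / (real r * (real r + 1))
      \<le> 1 - p_star k M S X Y"
    using Delta_le[of r] r(1) by (subst pos_divide_le_eq) (auto simp: mult.commute)
  moreover have "U_bound k (Delta k M S X Y) =
      1 - (2 * real r + 1 - real k + Delta k M S X Y) / (real r * (real r + 1))"
    unfolding U_bound_def r(2) by (simp add: algebra_simps)
  ultimately show ?thesis by simp
qed

lemma U_bound_le_U_simpl: "U_bound k (Delta k M S X Y) \<le> U_simpl k (Delta k M S X Y)"
proof -
  obtain r where r: "1 \<le> r" "of_int \<lceil>Delta k M S X Y\<rceil> = real k - real r"
    by (rule ceiling_Delta_eq_diff)
  define u where "u = real k - Delta k M S X Y"
  have u: "real r \<le> u" "u \<le> real r + 1"
    using ceiling_correct[of "Delta k M S X Y"] unfolding r(2) u_def by linarith+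
  \<comment> \<open>After clearing denominators the inequality says that \<open>u\<close> lies between the roots
    \<open>r\<close> and \<open>r + 1\<close> of a quadratic polynomial.\<close>
  have "0 \<le> (u - real r) * (real r + 1 - u)"
    using u by (intro mult_nonneg_nonneg) auto
  then have "real r * (real r + 1) \<le> (2 * real r + 1 - u) * u"
    by (simp add: algebra_simps)
  then have "1 / u \<le> (2 * real r + 1 - u) / (real r * (real r + 1))"
    using u r(1) by (simp add: divide_simps)
  moreover have "U_bound k (Delta k M S X Y) = 1 - (2 * real r + 1 - u) / (real r * (real r + 1))"
    unfolding U_bound_def r(2) u_def by (simp add: algebra_simps)
  ultimately show ?thesis
    by (simp add: U_simpl_def u_def)
qed

end

theorem theorem3:
  fixes M :: "'a measure" and S :: "'b measure"
    and X :: "'a \<Rightarrow> 'b" and Y :: "'a \<Rightarrow> nat" and k :: nat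
  assumes "k \<ge> 2"
    and "prob_space M"
    and "X \<in> M \<rightarrow>\<^sub>M S"
    and "Y \<in> M \<rightarrow>\<^sub>M count_space {1..k}"
  shows "L_bound k (Delta k M S X Y) \<le> p_star k M S X Y
    \<and> p_star k M S X Y \<le> U_bound k (Delta k M S X Y)
    \<and> U_bound k (Delta k M S X Y) \<le> U_simpl k (Delta k M S X Y)"
proof -
  interpret prob_space M by fact
  interpret classification M S X Y k
    by unfold_locales (use assms in auto)
  show ?thesis
    using L_bound_le_p_star p_star_le_U_bound U_bound_le_U_simpl by blast
qed

end
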